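(* Let $K$ be a field, let $A\in M_n(K)$, and let $f\in K[X]$ be a non-constant polynomial with $f(A)=0$. Assume that $g\in K[X]$ is a square-free polynomial and $m\in\mathbb{N}$ are such that $g\mid f$ and $f\mid g^m$. Let $\tilde g,\tilde g'\in K[X]$ be polynomials such that $1=\tilde g\, D(g)+\tilde g'\, g$ (these exist since $g$ and its formal derivative $D(g)$ are coprime). Define a sequence of matrices $(A_k)_{k\ge 0}$ in $M_n(K)$ by $$A_0:=A\qquad\text{and}\qquad A_{k+1}:=A_k-g(A_k)\cdot\tilde g(A_k)\quad\text{for } k\ge 0.$$ Let $k_0\ge 0$ be such that $2^{k_0}\ge m$. Then $g(A_{k_0})=0$, $A_{k_0}$ is semisimple and $A-A_{k_0}$ is nilpotent; furthermore, $A_{k_0}\in\mathfrak{A}:=\{r(A)\mid r\in K[X]\}$. Thus, setting $D:=A_{k_0}$ and $N:=A-A_{k_0}$, the decomposition $A=D+N$ is the Jordan--Chevalley decomposition of $A$; that is, $D$ is semisimple, $N$ is nilpotent, $D\cdot N=N\cdot D$, and $(D,N)$ is the unique pair of matrices in $M_n(K)$ with $A=D+N$ and these properties.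
   Context: $M_n(K)$ denotes the $n\times n$ matrices over $K$. For polynomials, $D\colon K[X]\to K[X]$ denotes the formal derivative: the $K$-linear map with $D(1)=0$ and $D(X^i)=iX^{i-1}$ for $i\ge 1$ (not to be confused with the matrix $D$ in the conclusion; $\tilde g'$ is just the name of a polynomial, not a derivative). A non-zero polynomial $g\in K[X]$ is called square-free if $\gcd(g,D(g))=1$, i.e. $g$ and $D(g)$ are coprime in $K[X]$. A matrix in $M_n(K)$ is called nilpotent if some power $A^j$ with $j\in\mathbb{N}$ is zero. A matrix in $M_n(K)$ is called semisimple if it is diagonalisable, possibly only over some larger field $L\supseteq K$. *)

theory Defs
  imports
    "Jordan_Normal_Form.Char_Poly"
    "Jordan_Normal_Form.DL_Rank"
    "HOL-Algebra.Algebraic_Closure_Type"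
begin

hide_const (open) Polynomials.lead_coeff UnivPoly.coeff Polynomials.degree UnivPoly.deg UnivPoly.monom up_ring.coeff up_ring.monom module.smult

definition square_free :: "'a :: field poly \<Rightarrow> bool" where
  "square_free g \<longleftrightarrow> g \<noteq> 0 \<and> coprime g (pderiv g)"

(* The entries of the matrix (\<Sum>k\<le>degree p. coeff p k \<cdot>\<^sub>m A ^\<^sub>m k). *)
definition poly_mat :: "'a :: field poly \<Rightarrow> 'a mat \<Rightarrow> 'a mat" where
  "poly_mat p A =
     mat (dim_row A) (dim_row A) (\<lambda>(i, j). \<Sum>k\<le>degree p. coeff p k * (A ^\<^sub>m k) $$ (i, j))"

definition nilpotent_mat :: "'a :: field mat \<Rightarrow> bool" where
  "nilpotent_mat A \<longleftrightarrow> (\<exists>j. A ^\<^sub>m j = 0\<^sub>m (dim_row A) (dim_row A))"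

definition diagonalizable :: "'a :: field mat \<Rightarrow> bool" where
  "diagonalizable A \<longleftrightarrow> (\<exists>B. diagonal_mat B \<and> similar_mat A B)"

(* Diagonalizable over some field extension. HOL cannot quantify existentially over types, so the
   extension is the algebraic closure. This loses nothing: by theorem
   semisimple_if_diagonalizable_over below, diagonalizability over an arbitrary extension field h
   implies it. *)
definition semisimple :: "'a :: field mat \<Rightarrow> bool" where
  "semisimple A \<longleftrightarrow> diagonalizable (map_mat to_ac A)"

definition jordan_chevalley :: "nat \<Rightarrow> 'a :: field mat \<Rightarrow> 'a mat \<Rightarrow> 'a mat \<Rightarrow> bool" where
  "jordan_chevalley n A D N \<longleftrightarrow>
     D \<in> carrier_mat n n \<and> N \<in> carrier_mat n n \<and> A = D + N \<and>
     semisimple D \<and> nilpotent_mat N \<and> D * N = N * D"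


lemma poly_mat_carrier [simp]: "A \<in> carrier_mat n n \<Longrightarrow> poly_mat p A \<in> carrier_mat n n"
  by (auto simp: poly_mat_def)

lemma poly_mat_dim [simp]: "dim_row (poly_mat p A) = dim_row A" "dim_col (poly_mat p A) = dim_row A"
  by (auto simp: poly_mat_def)

lemma poly_mat_index:
  assumes "A \<in> carrier_mat n n" "i < n" "j < n" "degree p \<le> N"
  shows "poly_mat p A $$ (i, j) = (\<Sum>k\<le>N. coeff p k * (A ^\<^sub>m k) $$ (i, j))"
proof -
  have "(\<Sum>k\<le>degree p. coeff p k * (A ^\<^sub>m k) $$ (i, j)) = (\<Sum>k\<le>N. coeff p k * (A ^\<^sub>m k) $$ (i, j))"
    by (rule sum.mono_neutral_left) (use assms(4) in \<open>auto simp: coeff_eq_0\<close>)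
  then show ?thesis
    using assms by (auto simp: poly_mat_def)
qed

lemma poly_mat_0 [simp]: "A \<in> carrier_mat n n \<Longrightarrow> poly_mat 0 A = 0\<^sub>m n n"
  by (rule eq_matI) (auto simp: poly_mat_def)

lemma poly_mat_add:
  assumes A: "A \<in> carrier_mat n n"
  shows "poly_mat (p + q) A = poly_mat p A + poly_mat q A"
proof (rule eq_matI)
  fix i j
  assume "i < dim_row (poly_mat p A + poly_mat q A)" "j < dim_col (poly_mat p A + poly_mat q A)"
  with A have ij: "i < n" "j < n" by (auto simp: poly_mat_def)
  define N where "N = max (degree p) (degree q)"
  have N: "degree p \<le> N" "degree q \<le> N" "degree (p + q) \<le> N"
    unfolding N_def by (auto intro: degree_add_le_max)
  show "poly_mat (p + q) A $$ (i, j) = (poly_mat p A + poly_mat q A) $$ (i, j)"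
    using A ij poly_mat_carrier[OF A, of q]
    by (simp add: poly_mat_index[OF A ij N(1)] poly_mat_index[OF A ij N(2)]
      poly_mat_index[OF A ij N(3)] sum.distrib algebra_simps)
qed (use A in \<open>auto simp: poly_mat_def\<close>)

lemma poly_mat_smult:
  assumes A: "A \<in> carrier_mat n n"
  shows "poly_mat (smult c p) A = c \<cdot>\<^sub>m poly_mat p A"
proof (rule eq_matI)
  fix i j
  assume "i < dim_row (c \<cdot>\<^sub>m poly_mat p A)" "j < dim_col (c \<cdot>\<^sub>m poly_mat p A)"
  with A have ij: "i < n" "j < n" by (auto simp: poly_mat_def)
  have N: "degree (smult c p) \<le> degree p" by (rule degree_smult_le)
  show "poly_mat (smult c p) A $$ (i, j) = (c \<cdot>\<^sub>m poly_mat p A) $$ (i, j)"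
    using A ij poly_mat_carrier[OF A, of p]
    by (simp add: poly_mat_index[OF A ij N] poly_mat_index[OF A ij order.refl]
      sum_distrib_left mult.assoc)
qed (use A in \<open>auto simp: poly_mat_def\<close>)

lemma zero_smult_mat [simp]: "A \<in> carrier_mat n m \<Longrightarrow> (0 :: 'a :: field) \<cdot>\<^sub>m A = 0\<^sub>m n m"
  by (rule eq_matI) auto

lemma poly_mat_pCons:
  assumes A: "A \<in> carrier_mat n n"
  shows "poly_mat (pCons c p) A = c \<cdot>\<^sub>m 1\<^sub>m n + poly_mat p A * A"
proof (rule eq_matI)
  fix i j
  assume "i < dim_row (c \<cdot>\<^sub>m 1\<^sub>m n + poly_mat p A * A)" "j < dim_col (c \<cdot>\<^sub>m 1\<^sub>m n + poly_mat p A * A)"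
  with A have ij: "i < n" "j < n" by (auto simp: poly_mat_def)
  have N: "degree (pCons c p) \<le> Suc (degree p)" by (rule degree_pCons_le)
  have "(poly_mat p A * A) $$ (i, j) = (\<Sum>l<n. poly_mat p A $$ (i, l) * A $$ (l, j))"
    using A ij poly_mat_carrier[OF A, of p]
    by (auto simp: scalar_prod_def lessThan_atLeast0 intro!: sum.cong)
  also have "\<dots> = (\<Sum>l<n. \<Sum>k\<le>degree p. coeff p k * ((A ^\<^sub>m k) $$ (i, l) * A $$ (l, j)))"
    by (intro sum.cong) (auto simp: poly_mat_index[OF A ij(1) _ order.refl] sum_distrib_right mult.assoc)
  also have "\<dots> = (\<Sum>k\<le>degree p. coeff p k * (\<Sum>l<n. (A ^\<^sub>m k) $$ (i, l) * A $$ (l, j)))"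
    by (subst sum.swap) (simp add: sum_distrib_left)
  also have "\<dots> = (\<Sum>k\<le>degree p. coeff p k * (A ^\<^sub>m Suc k) $$ (i, j))"
    using A ij pow_carrier_mat[OF A] by (auto simp: scalar_prod_def lessThan_atLeast0 intro!: sum.cong)
  finally show "poly_mat (pCons c p) A $$ (i, j) = (c \<cdot>\<^sub>m 1\<^sub>m n + poly_mat p A * A) $$ (i, j)"
    using A ij poly_mat_carrier[OF A, of p]
    by (simp add: poly_mat_index[OF A ij N] sum.atMost_Suc_shift del: sum.atMost_Suc pow_mat.simps(2))
qed (use A in \<open>auto simp: poly_mat_def\<close>)

lemma poly_mat_commute:
  assumes A: "A \<in> carrier_mat n n" and B: "B \<in> carrier_mat n n" and AB: "A * B = B * A"
  shows "poly_mat p A * B = B * poly_mat p A"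
proof (induction p)
  case 0
  show ?case using A B by simp
next
  case (pCons c p)
  note pA = poly_mat_carrier[OF A, of p]
  have "poly_mat (pCons c p) A * B = c \<cdot>\<^sub>m B + poly_mat p A * A * B"
    unfolding poly_mat_pCons[OF A]
    by (subst add_mult_distrib_mat[of _ n n _ _ n]) (use A B pA in \<open>auto simp: mult_smult_assoc_mat[of _ n n]\<close>)
  also have "poly_mat p A * A * B = poly_mat p A * B * A"
    using A B pA AB by (simp add: assoc_mult_mat[of _ n n _ n _ n])
  also have "\<dots> = B * (poly_mat p A * A)"
    using A B pA pCons by (simp add: assoc_mult_mat[of _ n n _ n _ n])
  also have "c \<cdot>\<^sub>m B + \<dots> = B * poly_mat (pCons c p) A"
    unfolding poly_mat_pCons[OF A]
    by (subst mult_add_distrib_mat[of _ n n _ n]) (use A B pA in \<open>auto simp: mult_smult_distrib[of _ n n]\<close>)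
  finally show ?case .
qed

lemma poly_mat_mult:
  assumes A: "A \<in> carrier_mat n n"
  shows "poly_mat (p * q) A = poly_mat p A * poly_mat q A"
proof (induction p)
  case 0
  show ?case using A left_mult_zero_mat[OF poly_mat_carrier[OF A, of q]] by simp
next
  case (pCons c p)
  note pA = poly_mat_carrier[OF A, of p] and qA = poly_mat_carrier[OF A, of q]
  have "poly_mat (pCons c p * q) A = c \<cdot>\<^sub>m poly_mat q A + poly_mat p A * poly_mat q A * A"
    using A pA qA left_add_zero_mat[of "poly_mat p A * poly_mat q A * A" n n]
    by (simp add: poly_mat_add[OF A] poly_mat_smult[OF A] poly_mat_pCons[OF A] pCons
      mult_carrier_mat[of _ n n _ n] zero_smult_mat[of _ n n])
  also have "poly_mat p A * poly_mat q A * A = poly_mat p A * A * poly_mat q A"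
    using A pA qA poly_mat_commute[OF A A refl, of q] by (simp add: assoc_mult_mat[of _ n n _ n _ n])
  also have "c \<cdot>\<^sub>m poly_mat q A + \<dots> = poly_mat (pCons c p) A * poly_mat q A"
    unfolding poly_mat_pCons[OF A]
    by (subst add_mult_distrib_mat[of _ n n _ _ n]) (use A pA qA in \<open>auto simp: mult_smult_assoc_mat[of _ n n]\<close>)
  finally show ?case .
qed

lemma poly_mat_similar:
  assumes w: "P \<in> carrier_mat n n" "B \<in> carrier_mat n n" "Q \<in> carrier_mat n n"
    "P * Q = 1\<^sub>m n" "Q * P = 1\<^sub>m n"
  shows "poly_mat p (P * B * Q) = P * poly_mat p B * Q"
proof (induction p)
  case 0
  show ?case using w by simp
next
  case (pCons c p)
  note pB = poly_mat_carrier[OF w(2), of p]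
  have PBQ: "P * B * Q \<in> carrier_mat n n" using w by auto
  have Pc: "P * (c \<cdot>\<^sub>m 1\<^sub>m n) = c \<cdot>\<^sub>m P"
    by (rule eq_matI) (use w in \<open>auto simp: mult_smult_distrib[of _ n n _ n]\<close>)
  have "P * poly_mat p B * Q * (P * B * Q) = P * poly_mat p B * (Q * P) * B * Q"
    using w(1,2,3) pB by (simp add: assoc_mult_mat[of _ n n _ n _ n] mult_carrier_mat[of _ n n _ n])
  then have "P * poly_mat p B * Q * (P * B * Q) = P * (poly_mat p B * B) * Q"
    using w pB by (simp add: assoc_mult_mat[of _ n n _ n _ n] mult_carrier_mat[of _ n n _ n])
  moreover have "P * (c \<cdot>\<^sub>m 1\<^sub>m n) * Q = c \<cdot>\<^sub>m 1\<^sub>m n"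
    using w by (simp add: Pc mult_smult_assoc_mat[of _ n n _ n])
  moreover have "P * (c \<cdot>\<^sub>m 1\<^sub>m n + poly_mat p B * B) * Q =
      P * (c \<cdot>\<^sub>m 1\<^sub>m n) * Q + P * (poly_mat p B * B) * Q"
    using w pB mult_carrier_mat[OF pB w(2)]
    by (simp add: mult_add_distrib_mat[of P n n _ n] add_mult_distrib_mat[of _ n n _ Q n] mult_carrier_mat[of _ n n _ n])
  ultimately show ?case
    unfolding poly_mat_pCons[OF PBQ] poly_mat_pCons[OF w(2)] pCons by simp
qed

lemma poly_mat_diagonal:
  assumes B: "B \<in> carrier_mat n n" and d: "diagonal_mat B" and ij: "i < n" "j < n"
  shows "poly_mat p B $$ (i, j) = (if i = j then poly p (B $$ (i, i)) else 0)"
  using ij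
proof (induction p arbitrary: i j)
  case 0
  then show ?case using B by simp
next
  case (pCons c p)
  have "(poly_mat p B * B) $$ (i, j) = (\<Sum>l<n. poly_mat p B $$ (i, l) * B $$ (l, j))"
    using B pCons.prems poly_mat_carrier[OF B, of p]
    by (auto simp: scalar_prod_def lessThan_atLeast0 intro!: sum.cong)
  also have "\<dots> = (\<Sum>l<n. if l = i then poly p (B $$ (i, i)) * B $$ (i, j) else 0)"
    using pCons.prems by (intro sum.cong) (auto simp: pCons.IH)
  also have "\<dots> = (if i = j then poly p (B $$ (i, i)) * B $$ (i, i) else 0)"
    using pCons.prems B d by (auto simp: diagonal_mat_def)
  finally show ?case
    unfolding poly_mat_pCons[OF B]
    using pCons.prems B poly_mat_carrier[OF B, of p] by (auto simp: mult.commute)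
qed

lemma poly_mat_hom:
  assumes h: "field_hom h" and A: "A \<in> carrier_mat n n"
  shows "poly_mat (map_poly h p) (map_mat h A) = map_mat h (poly_mat p A)"
proof -
  interpret h: field_hom h by (fact h)
  have hA: "map_mat h A \<in> carrier_mat n n" using A by simp
  show ?thesis
  proof (induction p)
    case 0
    show ?case using A by (auto intro!: eq_matI)
  next
    case (pCons c p)
    have "map_poly h (pCons c p) = pCons (h c) (map_poly h p)"
      by (cases "c = 0 \<and> p = 0") (auto simp: map_poly_pCons)
    then have "poly_mat (map_poly h (pCons c p)) (map_mat h A) =
        h c \<cdot>\<^sub>m 1\<^sub>m n + map_mat h (poly_mat p A) * map_mat h A"
      by (simp add: poly_mat_pCons[OF hA] pCons)
    also have "map_mat h (poly_mat p A) * map_mat h A = map_mat h (poly_mat p A * A)"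
      using h.mat_hom_mult[OF poly_mat_carrier[OF A] A] by simp
    also have "h c \<cdot>\<^sub>m 1\<^sub>m n + \<dots> = map_mat h (poly_mat (pCons c p) A)"
      unfolding poly_mat_pCons[OF A] using A
      by (intro eq_matI) (auto simp: h.hom_add h.hom_mult simp del: index_mult_mat(1))
    finally show ?case .
  qed
qed


lemma coprime_linear_poly: "a \<noteq> b \<Longrightarrow> coprime [:- a, 1:] [:- b, 1 :: 'a :: field:]"
proof (rule coprimeI)
  fix c assume ab: "a \<noteq> b" and "c dvd [:- a, 1:]" "c dvd [:- b, 1:]"
  then have "c dvd [:- a, 1:] - [:- b, 1:]" by (rule_tac dvd_diff)
  then have "c dvd [:b - a:]" by simp
  moreover have "[:b - a:] dvd 1" using ab by (simp add: is_unit_const_poly_iff dvd_field_iff)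
  ultimately show "is_unit c" using dvd_trans by blast
qed

lemma bezout_poly:
  "\<exists>u v. u * p + v * q dvd p \<and> u * p + v * q dvd (q :: 'a :: field poly)"
proof (induction "if q = 0 then 0 else Suc (degree q)" arbitrary: p q rule: less_induct)
  case less
  show ?case
  proof (cases "q = 0")
    case True
    then show ?thesis by (intro exI[of _ 1] exI[of _ 0]) simp
  next
    case False
    then have "(if p mod q = 0 then 0 else Suc (degree (p mod q))) < (if q = 0 then 0 else Suc (degree q))"
      using degree_mod_less[of q p] by auto
    from less[OF this, of q]
    obtain u v where uv: "u * q + v * (p mod q) dvd q" "u * q + v * (p mod q) dvd p mod q"
      by blast
    define d where "d = u * q + v * (p mod q)"
    have "d dvd p div q * q + p mod q"
      using uv by (intro dvd_add dvd_mult) (simp_all add: d_def)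
    then have "d dvd p" by simp
    moreover have "d = v * p + (u - v * (p div q)) * q"
    proof -
      have "u * q + v * b = v * (a * q + b) + (u - v * a) * q" for a b :: "'a poly"
        by (simp add: algebra_simps)
      from this[of "p mod q" "p div q"] show ?thesis
        by (simp only: d_def div_mult_mod_eq)
    qed
    ultimately show ?thesis using uv by (metis d_def)
  qed
qed

lemma coprime_mult_poly:
  assumes "coprime p q" "coprime p (r :: 'a :: field poly)"
  shows "coprime p (q * r)"
proof (rule coprimeI)
  fix c assume c: "c dvd p" "c dvd q * r"
  obtain u v where d: "u * p + v * q dvd p" "u * p + v * q dvd q"
    using bezout_poly by blast
  with assms(1) have unit: "u * p + v * q dvd 1" by (rule coprime_common_divisor)
  have "c dvd u * r * p + v * (q * r)" 
    using dvd_mult[OF c(1), of "u * r"] dvd_mult[OF c(2), of v] by (rule dvd_add)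
  also have "\<dots> = (u * p + v * q) * r" by (simp add: algebra_simps)
  finally have "c dvd (u * p + v * q) * r" .
  moreover have "(u * p + v * q) * r dvd r" using mult_dvd_mono[OF unit dvd_refl[of r]] by simp
  ultimately have "c dvd r" by (rule dvd_trans)
  then show "is_unit c" using assms(2) c(1) coprime_common_divisor by blast
qed

lemma coprime_add_dvd: "coprime p q \<Longrightarrow> p dvd r \<Longrightarrow> coprime p (r + q :: 'a :: field poly)"
  by (meson coprime_def dvd_add_right_iff dvd_trans)

lemma coprime_prod_poly:
  assumes "\<And>x. x \<in> S \<Longrightarrow> coprime p (f x :: 'a :: field poly)"
  shows "coprime p (prod f S)"
  using assms by (induction S rule: infinite_finite_induct) (auto intro: coprime_mult_poly)

lemma coprime_pderiv_prod_linear: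
  assumes "finite S"
  shows "coprime (\<Prod>a\<in>S. [:- a, 1 :: 'a :: field:]) (pderiv (\<Prod>a\<in>S. [:- a, 1:]))"
  using assms
proof (induction S rule: finite_induct)
  case (insert a S)
  define Q where "Q = (\<Prod>a\<in>S. [:- a, 1 :: 'a:])"
  define l where "l = [:- a, 1 :: 'a:]"
  have eq: "(\<Prod>a\<in>insert a S. [:- a, 1:]) = l * Q"
    using insert by (simp add: Q_def l_def)
  have lQ: "coprime l Q"
    unfolding l_def Q_def using insert.hyps
    by (auto intro!: coprime_prod_poly coprime_linear_poly)
  have d: "pderiv (l * Q) = l * pderiv Q + Q"
    unfolding pderiv_mult by (simp add: l_def pderiv_pCons)
  have "coprime l (l * pderiv Q + Q)"
    using lQ by (intro coprime_add_dvd) simp_all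
  moreover have "coprime Q (Q + l * pderiv Q)"
    using lQ insert.IH by (intro coprime_add_dvd coprime_mult_poly) (simp_all add: coprime_commute Q_def)
  ultimately show ?case 
    unfolding eq d by (metis add.commute coprime_commute coprime_mult_poly)
qed simp

lemma coprime_pderiv_dvd:
  assumes "coprime q (pderiv q)" "(p :: 'a :: field poly) dvd q"
  shows "coprime p (pderiv p)"
proof (rule coprimeI)
  obtain s where s: "q = p * s" using assms(2) by blast
  fix c assume c: "c dvd p" "c dvd pderiv p"
  then have "c dvd q" "c dvd pderiv q"
    by (auto simp: s pderiv_mult)
  then show "is_unit c" using assms(1) coprime_common_divisor by blast
qed

lemma coprime_pderiv_hom:
  assumes "field_hom h"
  shows "coprime (map_poly h p) (pderiv (map_poly h p)) \<longleftrightarrow> coprime p (pderiv (p :: 'a :: field poly))"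
proof -
  interpret h: field_hom h by (fact assms)
  interpret mh: map_poly_inj_idom_hom h ..
  show ?thesis
  proof
    assume co: "coprime (map_poly h p) (pderiv (map_poly h p))"
    show "coprime p (pderiv p)"
    proof (rule coprimeI)
      fix c assume "c dvd p" "c dvd pderiv p"
      then have "map_poly h c dvd map_poly h p" "map_poly h c dvd pderiv (map_poly h p)"
        by (auto simp: h.map_poly_pderiv[symmetric] intro!: mh.hom_dvd)
      with co have "is_unit (map_poly h c)" by (rule coprime_common_divisor)
      then show "is_unit c" by (auto simp: is_unit_iff_degree)
    qed
  next
    assume co: "coprime p (pderiv p)"
    show "coprime (map_poly h p) (pderiv (map_poly h p))"
    proof (rule coprimeI)
      obtain u v where "u * p + v * pderiv p dvd p" "u * p + v * pderiv p dvd pderiv p"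
        using bezout_poly by blast
      with co have unit: "is_unit (u * p + v * pderiv p)" by (rule coprime_common_divisor)
      fix c assume c: "c dvd map_poly h p" "c dvd pderiv (map_poly h p)"
      have "is_unit (map_poly h (u * p + v * pderiv p))"
        using mh.hom_dvd[OF unit] by simp
      moreover have "c dvd map_poly h (u * p + v * pderiv p)"
        using c by (simp add: mh.hom_mult mh.hom_add h.map_poly_pderiv)
      ultimately show "is_unit c" by (rule dvd_unit_imp_unit[rotated])
    qed
  qed
qed

lemma extension_retraction:
  fixes h :: "'a :: field \<Rightarrow> 'b :: field"
  assumes "field_hom h"
  shows "\<exists>f. (\<forall>x y. f (x + y) = f x + f y) \<and> (\<forall>c x. f (h c * x) = c * f x) \<and> f 1 = 1"
proof -
  interpret h: field_hom h by (fact assms)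
  interpret vs: vector_space_pair "\<lambda>c x. h c * x" "(*) :: 'a \<Rightarrow> 'a \<Rightarrow> 'a"
    by unfold_locales (auto simp: algebra_simps h.hom_add h.hom_mult)
  have ind: "vs.vs1.independent {1}" by simp
  define f where "f = vs.construct {1} (\<lambda>_. 1)"
  interpret l: Vector_Spaces.linear "\<lambda>c x. h c * x" "(*) :: 'a \<Rightarrow> 'a \<Rightarrow> 'a" f
    unfolding f_def by (rule vs.linear_construct[OF ind])
  have "f 1 = 1" using vs.construct_basis[OF ind, of 1] by (simp add: f_def)
  then show ?thesis using l.add l.scale by blast
qed

lemma annihilator_descends:
  fixes q :: "'b :: field poly"
  assumes h: "field_hom h" and A: "A \<in> carrier_mat n n"
    and q: "poly_mat q (map_mat h A) = 0\<^sub>m n n" "lead_coeff q = 1"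
  obtains p where "lead_coeff p = 1" "degree p = degree q" "poly_mat p A = 0\<^sub>m n n"
proof -
  interpret h: field_hom h by (fact h)
  obtain f where f: "\<And>x y. f (x + y) = f x + f y" "\<And>c x. f (h c * x) = c * f x" "f 1 = 1"
    using extension_retraction[OF h] by blast
  have f0: "f 0 = 0" using f(2)[of 0 0] by simp
  have fsum: "f (\<Sum>k\<in>I. g k) = (\<Sum>k\<in>I. f (g k))" for g :: "nat \<Rightarrow> 'b" and I
    by (induction I rule: infinite_finite_induct) (auto simp: f f0)
  define p where "p = map_poly f q"
  have cf: "coeff p k = f (coeff q k)" for k
    by (simp add: p_def coeff_map_poly f0)
  have deg: "degree p = degree q"
  proof (rule antisym)
    show "degree p \<le> degree q" unfolding p_def by (rule degree_map_poly_le)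
    show "degree q \<le> degree p" by (rule le_degree) (simp add: cf q f)
  qed
  have hA: "map_mat h A \<in> carrier_mat n n" using A by simp
  have "poly_mat p A $$ (i, j) = 0" if ij: "i < n" "j < n" for i j
  proof -
    have "poly_mat q (map_mat h A) $$ (i, j) = (\<Sum>k\<le>degree q. h ((A ^\<^sub>m k) $$ (i, j)) * coeff q k)"
      using A ij pow_carrier_mat[OF A]
      by (subst poly_mat_index[OF hA ij order.refl]) (simp add: h.mat_hom_pow[OF A, symmetric] mult.commute)
    then have "0 = (\<Sum>k\<le>degree q. h ((A ^\<^sub>m k) $$ (i, j)) * coeff q k)"
      using ij q(1) by simp
    then have "f 0 = f (\<Sum>k\<le>degree q. h ((A ^\<^sub>m k) $$ (i, j)) * coeff q k)"
      by (rule arg_cong)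
    also have "\<dots> = (\<Sum>k\<le>degree q. (A ^\<^sub>m k) $$ (i, j) * f (coeff q k))"
      by (simp add: fsum f(2))
    also have "\<dots> = poly_mat p A $$ (i, j)"
      unfolding poly_mat_index[OF A ij order.refl] by (simp add: cf deg mult.commute)
    finally show ?thesis by (simp add: f0)
  qed
  then have "poly_mat p A = 0\<^sub>m n n" using A by (intro eq_matI) auto
  moreover have "lead_coeff p = 1" using q(2) by (simp add: cf deg f)
  ultimately show thesis using that deg by blast
qed

lemma min_annihilator_dvd:
  fixes q :: "'b :: field poly"
  assumes h: "field_hom h" and A: "A \<in> carrier_mat n n"
    and m: "lead_coeff m = 1" "poly_mat m A = 0\<^sub>m n n"
    and min: "\<And>p. lead_coeff p = 1 \<Longrightarrow> poly_mat p A = 0\<^sub>m n n \<Longrightarrow> degree m \<le> degree p"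
    and q: "poly_mat q (map_mat h A) = 0\<^sub>m n n"
  shows "map_poly h m dvd q"
proof (rule ccontr)
  interpret h: field_hom h by (fact h)
  have hA: "map_mat h A \<in> carrier_mat n n" using A by simp
  define M where "M = map_poly h m"
  define r where "r = q mod M"
  assume "\<not> map_poly h m dvd q"
  then have r0: "r \<noteq> 0" by (auto simp: r_def M_def dvd_eq_mod_eq_0)
  have M0: "M \<noteq> 0" and dM: "degree M = degree m" using m(1) by (auto simp: M_def)
  have deg: "degree r < degree m"
    using degree_mod_less'[of M q] M0 r0 dM by (simp add: r_def)
  have MA: "poly_mat M (map_mat h A) = 0\<^sub>m n n"
    unfolding M_def poly_mat_hom[OF h A] m(2) by (auto intro!: eq_matI)
  have "poly_mat (q div M * M + r) (map_mat h A) = 0\<^sub>m n n"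
    by (simp add: r_def q)
  then have rA: "poly_mat r (map_mat h A) = 0\<^sub>m n n"
    unfolding poly_mat_add[OF hA] poly_mat_mult[OF hA] MA
    using poly_mat_carrier[OF hA, of r] right_mult_zero_mat[OF poly_mat_carrier[OF hA, of "q div M"]]
    by simp
  define s where "s = smult (inverse (lead_coeff r)) r"
  have "lead_coeff s = 1" "degree s = degree r" using r0 by (auto simp: s_def)
  moreover have "poly_mat s (map_mat h A) = 0\<^sub>m n n"
    unfolding s_def poly_mat_smult[OF hA] rA by (auto intro!: eq_matI)
  ultimately show False
    using annihilator_descends[OF h A, of s] min deg by (metis not_le)
qed

lemma smult_mat_mult_vec:
  "A \<in> carrier_mat n m \<Longrightarrow> v \<in> carrier_vec m \<Longrightarrow> (c \<cdot>\<^sub>m A) *\<^sub>v v = c \<cdot>\<^sub>v (A *\<^sub>v (v :: 'a :: field vec))"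
  by (rule eq_vecI) auto

lemma eigenvectors_span:
  assumes A: "A \<in> carrier_mat n n" and "finite S"
    and add: "\<And>v w. v \<in> W \<Longrightarrow> w \<in> W \<Longrightarrow> v + w \<in> W"
    and smult: "\<And>c v. v \<in> W \<Longrightarrow> c \<cdot>\<^sub>v v \<in> W"
    and ev: "\<And>a v. v \<in> carrier_vec n \<Longrightarrow> A *\<^sub>v v = a \<cdot>\<^sub>v v \<Longrightarrow> v \<in> W"
    and v: "v \<in> carrier_vec n" "poly_mat (\<Prod>a\<in>S. [:- a, 1 :: 'a :: field:]) A *\<^sub>v v = 0\<^sub>v n"
  shows "v \<in> W"
  using assms(2) v
proof (induction S arbitrary: v rule: finite_induct)
  case empty
  have "poly_mat (1 :: 'a poly) A = 1\<^sub>m n"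
    using A by (simp add: one_pCons poly_mat_pCons) (auto intro!: eq_matI)
  with empty have "v = 0\<^sub>v n" by simp
  then show ?case using A by (intro ev[of _ 0]) auto
next
  case (insert a S)
  define q where "q = (\<Prod>a\<in>S. [:- a, 1 :: 'a:])"
  define c where "c = poly q a"
  have c0: "c \<noteq> 0" using insert.hyps by (auto simp: c_def q_def poly_prod)
  have qA: "poly_mat q A \<in> carrier_mat n n" using A by simp
  define w where "w = poly_mat q A *\<^sub>v v"
  have w: "w \<in> carrier_vec n" using qA insert.prems by (auto simp: w_def)
  have lin: "poly_mat [:- a, 1:] A = - a \<cdot>\<^sub>m 1\<^sub>m n + A"
    using A by (auto simp: poly_mat_pCons intro!: eq_matI)
  have lin_v: "poly_mat [:- a, 1:] A *\<^sub>v x = - a \<cdot>\<^sub>v x + A *\<^sub>v x" if "x \<in> carrier_vec n" for x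
    unfolding lin using A that by (simp add: add_mult_distrib_mat_vec[of _ n n] smult_mat_mult_vec[of _ n n])
  have "0\<^sub>v n = poly_mat ([:- a, 1:] * q) A *\<^sub>v v"
    using insert by (simp add: q_def)
  also have "\<dots> = - a \<cdot>\<^sub>v w + A *\<^sub>v w"
    unfolding poly_mat_mult[OF A] using lin_v[OF w] insert.prems qA poly_mat_carrier[OF A]
    by (simp add: w_def assoc_mult_mat_vec[of _ n n _ n])
  finally have w0: "0\<^sub>v n = - a \<cdot>\<^sub>v w + A *\<^sub>v w" .
  have Aw: "A *\<^sub>v w = a \<cdot>\<^sub>v w"
  proof (rule eq_vecI)
    fix i assume "i < dim_vec (a \<cdot>\<^sub>v w)"
    then have i: "i < n" using w by simp
    have "(- a \<cdot>\<^sub>v w + A *\<^sub>v w) $ i = 0" using i w0[symmetric] by simp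
    then show "(A *\<^sub>v w) $ i = (a \<cdot>\<^sub>v w) $ i" using i w A by simp
  qed (use A w in auto)
  have poly_w: "poly_mat p A *\<^sub>v w = poly p a \<cdot>\<^sub>v w" for p
  proof (induction p)
    case 0
    show ?case using A w by (auto intro!: eq_vecI)
  next
    case (pCons b p)
    have "poly_mat (pCons b p) A *\<^sub>v w = b \<cdot>\<^sub>v w + poly_mat p A *\<^sub>v (A *\<^sub>v w)"
      unfolding poly_mat_pCons[OF A] using A w poly_mat_carrier[OF A, of p]
      by (simp add: add_mult_distrib_mat_vec[of _ n n] smult_mat_mult_vec[of _ n n]
        assoc_mult_mat_vec[of _ n n _ n] mult_carrier_mat[of _ n n _ n])
    also have "poly_mat p A *\<^sub>v (A *\<^sub>v w) = a \<cdot>\<^sub>v (poly p a \<cdot>\<^sub>v w)"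
      unfolding Aw using w poly_mat_carrier[OF A, of p] pCons by (simp add: mult_mat_vec[of _ n n])
    also have "b \<cdot>\<^sub>v w + \<dots> = poly (pCons b p) a \<cdot>\<^sub>v w"
      using w by (auto intro!: eq_vecI simp: algebra_simps)
    finally show ?case .
  qed
  define x where "x = v + (- inverse c) \<cdot>\<^sub>v w"
  have x: "x \<in> carrier_vec n" using w insert.prems by (auto simp: x_def)
  have "poly_mat q A *\<^sub>v x = w + (- inverse c) \<cdot>\<^sub>v (c \<cdot>\<^sub>v w)"
    using w insert.prems qA poly_w[of q]
    by (simp add: x_def mult_add_distrib_mat_vec[of _ n n] mult_mat_vec[of _ n n] w_def[symmetric] c_def)
  also have "\<dots> = 0\<^sub>v n"
    using w c0 by (auto intro!: eq_vecI)
  finally have "x \<in> W" using x insert.IH by (simp add: q_def)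
  moreover have "w \<in> W" using ev[OF w Aw] .
  ultimately have "x + inverse c \<cdot>\<^sub>v w \<in> W" using add smult by blast
  moreover have "x + inverse c \<cdot>\<^sub>v w = v"
    using w insert.prems by (auto intro!: eq_vecI simp: x_def)
  ultimately show ?case by simp
qed

lemma diagonalizable_if_annihilated:
  assumes A: "A \<in> carrier_mat n n" and S: "finite S"
    and ann: "poly_mat (\<Prod>a\<in>S. [:- a, 1 :: 'a :: field:]) A = 0\<^sub>m n n"
  shows "diagonalizable A"
proof -
  interpret vec_space "TYPE('a)" n .
  define E where "E = {v \<in> carrier_vec n. \<exists>a. A *\<^sub>v v = a \<cdot>\<^sub>v v}"
  define P where "P Y \<longleftrightarrow> Y \<subseteq> E \<and> \<not> lin_dep Y" for Y
  have Ec: "E \<subseteq> carrier_vec n" by (auto simp: E_def)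
  have "finite Y \<and> card Y \<le> n" if "P Y" for Y
    using li_le_dim[of Y] that Ec by (auto simp: P_def dim_is_n)
  moreover have "P {}" by (auto simp: P_def lin_dep_def)
  ultimately obtain B where B: "finite B" "maximal B P"
    using maximal_exists[of P n "{}"] by blast
  have BE: "B \<subseteq> E" and Bli: "\<not> lin_dep B" using B(2) by (auto simp: maximal_def P_def)
  have Bc: "B \<subseteq> carrier_vec n" using BE Ec by blast
  have Esp: "v \<in> span B" if "v \<in> E" for v
  proof (rule ccontr)
    assume nv: "v \<notin> span B"
    then have vB: "v \<notin> B" using in_own_span[of B] Bc by auto
    have "\<not> lin_dep (B \<union> {v})"
      using lin_dep_iff_in_span[of B v] nv vB Bc Bli that Ec by auto
    then have "P (B \<union> {v})" using BE that by (auto simp: P_def)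
    then show False using B(2) vB by (auto simp: maximal_def)
  qed
  have "v \<in> span B" if v: "v \<in> carrier_vec n" for v
  proof (rule eigenvectors_span[OF A S _ _ _ v])
    show "x + y \<in> span B" if "x \<in> span B" "y \<in> span B" for x y
      using span_add1[OF Bc that] by simp
    show "c \<cdot>\<^sub>v x \<in> span B" if "x \<in> span B" for c x
      using smult_in_span[OF Bc that] .
    show "x \<in> span B" if "x \<in> carrier_vec n" "A *\<^sub>v x = a \<cdot>\<^sub>v x" for a x
      using Esp that by (auto simp: E_def)
    show "poly_mat (\<Prod>a\<in>S. [:- a, 1:]) A *\<^sub>v v = 0\<^sub>v n"
      unfolding ann using v by (auto intro!: eq_vecI)
  qed
  then have "basis B"
    using Bc Bli span_is_subset2[OF Bc] by (auto simp: basis_def)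
  then have card: "card B = n" using dim_basis[OF B(1)] dim_is_n by simp
  obtain bs where bs: "set bs = B" "distinct bs" using finite_distinct_list[OF B(1)] by blast
  have len: "length bs = n" using bs card distinct_card by fastforce
  define T where "T = mat_of_cols n bs"
  have T: "T \<in> carrier_mat n n" using len by (simp add: T_def carrier_matI)
  have colsT: "cols T = bs" using bs Bc by (simp add: T_def)
  have "det T \<noteq> 0"
    using det_rank_iff[OF T] lin_indpt_full_rank[OF T] colsT bs Bli by simp
  then obtain Q where Q: "Q \<in> carrier_mat n n" "T * Q = 1\<^sub>m n" "Q * T = 1\<^sub>m n"
    using det_non_zero_imp_unit[OF T, of "()"] by (auto simp: Units_def ring_mat_def)
  have "\<forall>j<n. \<exists>a. A *\<^sub>v (bs ! j) = a \<cdot>\<^sub>v (bs ! j)"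
    using BE bs len nth_mem by (fastforce simp: E_def)
  then obtain e where e: "\<And>j. j < n \<Longrightarrow> A *\<^sub>v (bs ! j) = e j \<cdot>\<^sub>v (bs ! j)" by metis
  define D where "D = mat_diag n e"
  have D: "D \<in> carrier_mat n n" by (simp add: D_def)
  have AT: "A * T = T * D"
  proof (rule eq_matI)
    fix i j assume "i < dim_row (T * D)" "j < dim_col (T * D)"
    then have ij: "i < n" "j < n" using T D by auto
    have colj: "col T j = bs ! j" using ij colsT T cols_nth[of j T] by simp
    have "(A * T) $$ (i, j) = (A *\<^sub>v (bs ! j)) $ i"
      using A T ij colj by simp
    also have "\<dots> = e j * (bs ! j) $ i"
      using e[OF ij(2)] ij colj T by (metis carrier_matD(1) dim_col index_smult_vec(1))
    also have "(bs ! j) $ i = T $$ (i, j)" using colj[symmetric] T ij by simp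
    finally show "(A * T) $$ (i, j) = (T * D) $$ (i, j)"
      unfolding D_def mat_diag_mult_right[OF T] using ij by simp
  qed (use A T D in auto)
  have "A = A * (T * Q)" using A Q by simp
  also have "\<dots> = T * D * Q"
    using A T Q(1) D AT by (simp add: assoc_mult_mat[of A n n T n Q n, symmetric])
  finally have "similar_mat A D" using A T Q D by (intro similar_matI[of _ _ T Q n]) auto
  moreover have "diagonal_mat D" by (auto simp: D_def mat_diag_def diagonal_mat_def)
  ultimately show ?thesis by (auto simp: diagonalizable_def)
qed

lemma diagonalizable_if_separable:
  fixes A :: "'a :: alg_closed_field mat"
  assumes A: "A \<in> carrier_mat n n" and q: "q \<noteq> 0" "coprime q (pderiv q)" "poly_mat q A = 0\<^sub>m n n"
  shows "diagonalizable A"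
proof -
  obtain M where M: "q = smult (lead_coeff q) (\<Prod>x\<in>#M. [:- x, 1:])"
    using alg_closed_imp_factorization[OF q(1)] by blast
  have "count M x \<le> 1" for x
  proof (rule ccontr)
    assume "\<not> count M x \<le> 1"
    then have "replicate_mset 2 x \<subseteq># M" by (subst count_le_replicate_mset_subset_eq[symmetric]) simp
    then obtain N where N: "M = replicate_mset 2 x + N" by (elim subset_mset.le_iff_add[THEN iffD1, THEN exE])
    define R where "R = smult (lead_coeff q) (\<Prod>x\<in>#N. [:- x, 1:])"
    have "q = [:- x, 1:] * ([:- x, 1:] * R)"
      by (subst M) (simp add: N R_def numeral_2_eq_2 del: mult_pCons_left mult_pCons_right)
    then have "[:- x, 1:] dvd q" "[:- x, 1:] dvd pderiv q"
      by (auto simp: pderiv_mult simp del: mult_pCons_left)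
    then have "is_unit [:- x, 1:]" using q(2) coprime_common_divisor by blast
    then show False by (simp add: is_unit_poly_iff)
  qed
  then have "count M x = count (mset_set (set_mset M)) x" for x
    by (cases "x \<in># M") (auto simp: not_in_iff le_Suc_eq intro: le_antisym Suc_leI)
  then have "M = mset_set (set_mset M)"
    by (rule multiset_eqI)
  then have "(\<Prod>x\<in>#M. [:- x, 1:]) = (\<Prod>x\<in>set_mset M. [:- x, 1:])"
    by (metis prod_unfold_prod_mset)
  then have q': "q = smult (lead_coeff q) (\<Prod>x\<in>set_mset M. [:- x, 1:])"
    using M by simp
  have "(\<Prod>x\<in>set_mset M. [:- x, 1:]) = smult (inverse (lead_coeff q)) q"
    using q(1) by (subst (2) q') simp
  then have "poly_mat (\<Prod>x\<in>set_mset M. [:- x, 1:]) A = 0\<^sub>m n n"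
    using q(3) by (auto simp: poly_mat_smult[OF A] intro!: eq_matI)
  then show ?thesis using diagonalizable_if_annihilated[OF A finite_set_mset] by blast
qed

lemma annihilator_if_diagonalizable:
  assumes A: "A \<in> carrier_mat n n" and "diagonalizable A"
  obtains S where "finite S" "poly_mat (\<Prod>a\<in>S. [:- a, 1 :: 'a :: field:]) A = 0\<^sub>m n n"
proof -
  obtain B where B: "diagonal_mat B" "similar_mat A B" using assms by (auto simp: diagonalizable_def)
  obtain m P Q where "{A, B, P, Q} \<subseteq> carrier_mat m m" and PQ: "P * Q = 1\<^sub>m m" "Q * P = 1\<^sub>m m" "A = P * B * Q"
    using similar_matD[OF B(2)] by blast
  with A have [simp]: "m = n" and c: "B \<in> carrier_mat n n" "P \<in> carrier_mat n n" "Q \<in> carrier_mat n n"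
    by auto
  define S where "S = (\<lambda>i. B $$ (i, i)) ` {..<n}"
  define q where "q = (\<Prod>a\<in>S. [:- a, 1:])"
  have fin: "finite S" by (simp add: S_def)
  have "poly_mat q B = 0\<^sub>m n n"
    using c(1) fin by (intro eq_matI)
      (auto simp: poly_mat_diagonal[OF c(1) B(1)] q_def poly_prod prod_zero_iff S_def)
  then have "poly_mat q A = 0\<^sub>m n n"
    using poly_mat_similar[OF c(2,1,3)] PQ c by simp
  with fin that show thesis by (simp add: q_def)
qed

lemma field_hom_to_ac: "field_hom to_ac"
  by unfold_locales auto

theorem semisimple_if_diagonalizable_over:
  fixes h :: "'a :: field \<Rightarrow> 'b :: field"
  assumes h: "field_hom h" and A: "A \<in> carrier_mat n n" and diag: "diagonalizable (map_mat h A)"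
  shows "semisimple A"
proof -
  have hA: "map_mat h A \<in> carrier_mat n n" using A by simp
  obtain S where S: "finite S" "poly_mat (\<Prod>a\<in>S. [:- a, 1:]) (map_mat h A) = 0\<^sub>m n n"
    using annihilator_if_diagonalizable[OF hA diag] .
  define q where "q = (\<Prod>a\<in>S. [:- a, 1 :: 'b:])"
  have q1: "lead_coeff q = 1" unfolding q_def lead_coeff_prod by simp
  define ann where "ann p \<longleftrightarrow> lead_coeff p = 1 \<and> poly_mat p A = 0\<^sub>m n n" for p
  obtain p where "ann p"
    using annihilator_descends[OF h A S(2)] q1 unfolding ann_def q_def by blast
  then have "\<exists>m. ann m \<and> (\<forall>p. ann p \<longrightarrow> degree m \<le> degree p)"
    by (rule ex_has_least_nat)
  then obtain m where m: "ann m" "\<And>p. ann p \<Longrightarrow> degree m \<le> degree p"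
    by blast
  have "map_poly h m dvd q"
    using m by (intro min_annihilator_dvd[OF h A]) (simp_all add: ann_def q_def S(2))
  then have "coprime (map_poly h m) (pderiv (map_poly h m))"
    using coprime_pderiv_dvd coprime_pderiv_prod_linear[OF S(1)] by (auto simp: q_def)
  then have "coprime (map_poly to_ac m) (pderiv (map_poly to_ac m))"
    by (simp add: coprime_pderiv_hom[OF h] coprime_pderiv_hom[OF field_hom_to_ac])
  moreover have "map_poly to_ac m \<noteq> 0"
  proof
    assume "map_poly to_ac m = 0"
    then have "to_ac (lead_coeff m) = 0" by (metis coeff_0 coeff_map_poly to_ac_0)
    then show False using m(1) by (simp add: ann_def)
  qed
  moreover have "poly_mat (map_poly to_ac m) (map_mat to_ac A) = 0\<^sub>m n n"
    
  proof -
    have "map_mat to_ac (0\<^sub>m n n) = 0\<^sub>m n n" by (rule eq_matI) auto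
    then show ?thesis using m(1) by (simp only: poly_mat_hom[OF field_hom_to_ac A] ann_def)
  qed
  ultimately show ?thesis
    unfolding semisimple_def using A by (intro diagonalizable_if_separable[of _ n]) auto
qed

end

theory Submission
  imports Defs
begin

text \<open>
The annihilation statements about the matrices \<open>As k\<close> come from two divisibilities in
\<open>K[X]\<close>. The recursion is Newton's iteration \<open>x \<mapsto> x - g x / g' x\<close> for a root of \<open>g\<close>,
in which the Bezout cofactor of \<open>g'\<close> replaces \<open>1 / g'\<close>; the two agree modulo \<open>g\<close>. Started
at the indeterminate \<open>X\<close> it produces polynomials \<open>P\<^sub>k\<close> with \<open>As k = P\<^sub>k(A)\<close>. By Taylor's
formula every step squares the error, so \<open>g ^ (2 ^ k)\<close> divides \<open>g(P\<^sub>k)\<close>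
(lemma \<open>power_dvd_newton_poly\<close>), while each correction is a multiple of \<open>g\<close>, so \<open>g\<close> divides
\<open>X - P\<^sub>k\<close> (lemma \<open>dvd_X_minus_newton_poly\<close>). Since \<open>f\<close> divides \<open>g ^ m\<close> and kills \<open>A\<close>, the
first divisibility gives \<open>g(As k) = 0\<close> as soon as \<open>2 ^ k \<ge> m\<close>, whence \<open>As k\<close> is semisimple
because \<open>g\<close> is square-free; the second one gives \<open>(A - As k) ^ m = 0\<close>.

For uniqueness, let \<open>A = D' + N'\<close> be another decomposition. As \<open>D'\<close> and \<open>N'\<close> commute with
\<open>A\<close>, they commute with its polynomials \<open>D = As k\<close> and \<open>N = A - D\<close>. So \<open>E = D' - D = N - N'\<close>
is a difference of commuting nilpotent matrices, hence nilpotent (lemma \<open>nilpotent_mat_add\<close>).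
Over the algebraic closure, \<open>D\<close> and \<open>D'\<close> are killed by a common product \<open>q\<close> of distinct
linear factors. Newton's idea now works in reverse, as a statement that roots of a separable
polynomial cannot be infinitesimally close: Taylor's formula turns \<open>q(D + E) = 0\<close> into
\<open>E q'(D) = - E\<^sup>2 R\<close>, the matrix \<open>q'(D)\<close> is invertible, and so \<open>E\<close> is a multiple of
\<open>E\<^sup>2\<close>, which forces the nilpotent matrix \<open>E\<close> to vanish
(lemma \<open>eq_if_separable_nilpotent_diff\<close>).
\<close>

section \<open>Polynomials in a matrix\<close>

lemma poly_mat_1 [simp]: "A \<in> carrier_mat n n \<Longrightarrow> poly_mat 1 A = 1\<^sub>m n"
  by (simp add: one_pCons poly_mat_pCons) (auto intro!: eq_matI)

lemma poly_mat_X [simp]: "A \<in> carrier_mat n n \<Longrightarrow> poly_mat [:0, 1:] A = A"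
  by (auto simp: poly_mat_pCons intro!: eq_matI)

lemma poly_mat_diff:
  assumes A: "A \<in> carrier_mat n n"
  shows "poly_mat (p - q) A = poly_mat p A - poly_mat q A"
proof -
  have "poly_mat (p - q) A = poly_mat (p + smult (- 1) q) A" by simp
  also have "\<dots> = poly_mat p A - poly_mat q A"
    unfolding poly_mat_add[OF A] poly_mat_smult[OF A] using A by (auto intro!: eq_matI)
  finally show ?thesis .
qed

lemma poly_mat_power:
  assumes A: "A \<in> carrier_mat n n"
  shows "poly_mat (p ^ k) A = poly_mat p A ^\<^sub>m k"
proof (induction k)
  case (Suc k)
  then show ?case by (simp add: power_Suc2 poly_mat_mult[OF A] del: power_Suc)
qed (use A in simp)

text \<open>Composition is what makes the matrix recursion the image of a recursion in the polynomial
ring.\<close>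

lemma poly_mat_pcompose:
  assumes A: "A \<in> carrier_mat n n"
  shows "poly_mat (p \<circ>\<^sub>p q) A = poly_mat p (poly_mat q A)"
proof (induction p)
  case (pCons c p)
  have "poly_mat [:c:] A = c \<cdot>\<^sub>m 1\<^sub>m n"
    using A by (auto simp: poly_mat_pCons intro!: eq_matI)
  then show ?case
    by (simp add: pcompose_pCons poly_mat_add[OF A] mult.commute[of q] poly_mat_mult[OF A]
      poly_mat_pCons[OF poly_mat_carrier[OF A]] pCons)
qed (use A in \<open>simp add: poly_mat_0[OF poly_mat_carrier[OF A]]\<close>)

lemma poly_mat_dvd_zero:
  assumes A: "A \<in> carrier_mat n n" and "p dvd q" and "poly_mat p A = 0\<^sub>m n n"
  shows "poly_mat q A = 0\<^sub>m n n"
proof -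
  obtain r where "q = p * r" using assms(2) by blast
  then show ?thesis
    using assms(3) left_mult_zero_mat[OF poly_mat_carrier[OF A, of r]] by (simp add: poly_mat_mult[OF A])
qed

section \<open>Newton iteration in the polynomial ring\<close>

text \<open>Taylor's formula to first order. Divisibility of the remainder by \<open>h ^ 2\<close> avoids the second
derivative, whose factor \<open>1 / 2\<close> is meaningless in characteristic two.\<close>

lemma pcompose_diff_taylor:
  fixes p x h :: "'a :: field poly"
  shows "h ^ 2 dvd p \<circ>\<^sub>p (x - h) - (p \<circ>\<^sub>p x - (pderiv p \<circ>\<^sub>p x) * h)"
proof (induction p)
  case (pCons c p)
  define r where "r = p \<circ>\<^sub>p (x - h) - (p \<circ>\<^sub>p x - (pderiv p \<circ>\<^sub>p x) * h)"
  have p: "p \<circ>\<^sub>p (x - h) = p \<circ>\<^sub>p x - (pderiv p \<circ>\<^sub>p x) * h + r" by (simp add: r_def)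
  have "pCons c p \<circ>\<^sub>p (x - h) - (pCons c p \<circ>\<^sub>p x - (pderiv (pCons c p) \<circ>\<^sub>p x) * h) =
      r * (x - h) + h ^ 2 * (pderiv p \<circ>\<^sub>p x)"
    by (simp add: pcompose_pCons p pderiv_pCons pcompose_add algebra_simps power2_eq_square)
  also have "h ^ 2 dvd \<dots>" using pCons by (auto simp: r_def)
  finally show ?case .
qed simp

fun newton_poly :: "'a :: field poly \<Rightarrow> 'a poly \<Rightarrow> nat \<Rightarrow> 'a poly" where
  "newton_poly g gt 0 = [:0, 1:]"
| "newton_poly g gt (Suc k) = newton_poly g gt k - (g \<circ>\<^sub>p newton_poly g gt k) * (gt \<circ>\<^sub>p newton_poly g gt k)"

context
  fixes g gt gt' :: "'a :: field poly"
  assumes bezout: "1 = gt * pderiv g + gt' * g"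
begin

text \<open>With \<open>x = P\<^sub>k\<close> and \<open>h = g(x) gt(x)\<close>, the linear part of \<open>g(x - h)\<close> is
\<open>g(x) (1 - gt(x) g'(x))\<close>, and by the Bezout identity the second factor is again a multiple of
\<open>g(x)\<close>.\<close>

lemma newton_poly_quadratic: "(g \<circ>\<^sub>p newton_poly g gt k) ^ 2 dvd g \<circ>\<^sub>p newton_poly g gt (Suc k)"
proof -
  define x where "x = newton_poly g gt k"
  define h where "h = (g \<circ>\<^sub>p x) * (gt \<circ>\<^sub>p x)"
  have "1 \<circ>\<^sub>p x = (gt * pderiv g + gt' * g) \<circ>\<^sub>p x" by (simp only: bezout)
  then have B: "(gt \<circ>\<^sub>p x) * (pderiv g \<circ>\<^sub>p x) = 1 - (gt' \<circ>\<^sub>p x) * (g \<circ>\<^sub>p x)"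
    by (simp add: pcompose_add pcompose_mult pcompose_1 eq_diff_eq)
  have "(g \<circ>\<^sub>p x) - (pderiv g \<circ>\<^sub>p x) * h = (g \<circ>\<^sub>p x) - (g \<circ>\<^sub>p x) * ((gt \<circ>\<^sub>p x) * (pderiv g \<circ>\<^sub>p x))"
    by (simp add: h_def algebra_simps)
  also have "\<dots> = (g \<circ>\<^sub>p x) ^ 2 * (gt' \<circ>\<^sub>p x)"
    unfolding B by (simp add: algebra_simps power2_eq_square)
  finally have "(g \<circ>\<^sub>p x) ^ 2 dvd (g \<circ>\<^sub>p x) - (pderiv g \<circ>\<^sub>p x) * h" by simp
  moreover have "(g \<circ>\<^sub>p x) ^ 2 dvd g \<circ>\<^sub>p (x - h) - ((g \<circ>\<^sub>p x) - (pderiv g \<circ>\<^sub>p x) * h)"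
    by (rule dvd_trans[OF _ pcompose_diff_taylor]) (simp add: h_def power_mult_distrib)
  ultimately have "(g \<circ>\<^sub>p x) ^ 2 dvd g \<circ>\<^sub>p (x - h)"
    by (metis diff_add_cancel dvd_add)
  then show ?thesis by (simp add: x_def h_def)
qed

lemma power_dvd_newton_poly: "g ^ (2 ^ k) dvd g \<circ>\<^sub>p newton_poly g gt k"
proof (induction k)
  case (Suc k)
  have "g ^ (2 ^ Suc k) = (g ^ (2 ^ k)) ^ 2" by (simp add: power_mult[symmetric] mult.commute)
  also have "\<dots> dvd (g \<circ>\<^sub>p newton_poly g gt k) ^ 2" using Suc by (rule dvd_power_same)
  finally show ?case using newton_poly_quadratic dvd_trans by blast
qed (simp add: pcompose_idR)

lemma dvd_X_minus_newton_poly: "g dvd [:0, 1:] - newton_poly g gt k"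
proof (induction k)
  case (Suc k)
  have "g dvd g ^ (2 ^ k)" by simp
  then have "g dvd (g \<circ>\<^sub>p newton_poly g gt k) * (gt \<circ>\<^sub>p newton_poly g gt k)"
    using power_dvd_newton_poly[of k] dvd_trans by (meson dvd_mult2)
  then show ?case using Suc dvd_add by (fastforce simp: algebra_simps)
qed simp

end

section \<open>Commuting nilpotent matrices\<close>

lemma pow_mat_commute:
  fixes A B :: "'a :: semiring_1 mat"
  assumes A: "A \<in> carrier_mat n n" and B: "B \<in> carrier_mat n n" and AB: "A * B = B * A"
  shows "A ^\<^sub>m k * B = B * A ^\<^sub>m k"
proof (induction k)
  case 0
  show ?case using A B by simp
next
  case (Suc k)
  note Ak = pow_carrier_mat[OF A, of k]
  have "A ^\<^sub>m Suc k * B = A ^\<^sub>m k * B * A"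
    using assoc_mult_mat[OF Ak A B] assoc_mult_mat[OF Ak B A] AB by simp
  then show ?case using Suc assoc_mult_mat[OF B Ak A] by simp
qed

text \<open>The expansion of \<open>(N + M) ^ (i + j)\<close> into monomials, organised without binomial coefficients:
one factor \<open>N + M\<close> at a time is traded for one factor \<open>N\<close> or \<open>M\<close>, keeping the total degree at
least \<open>i + j\<close>, until a monomial is reached that contains \<open>N ^ i\<close> or \<open>M ^ j\<close>.\<close>

lemma nilpotent_mat_add:
  fixes M N :: "'a :: field mat"
  assumes N: "N \<in> carrier_mat n n" and M: "M \<in> carrier_mat n n" and NM: "N * M = M * N"
    and "nilpotent_mat N" "nilpotent_mat M"
  shows "nilpotent_mat (N + M)"
proof -
  obtain i j where ij: "N ^\<^sub>m i = 0\<^sub>m n n" "M ^\<^sub>m j = 0\<^sub>m n n"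
    using assms by (auto simp: nilpotent_mat_def)
  note c = N M pow_carrier_mat[OF N] pow_carrier_mat[OF M] add_carrier_mat[OF M]
    pow_carrier_mat[OF add_carrier_mat[OF M]] mult_carrier_mat[of _ n n _ n]
  have zero: "B ^\<^sub>m a = 0\<^sub>m n n" if "B \<in> carrier_mat n n" "B ^\<^sub>m l = 0\<^sub>m n n" "l \<le> a" for B :: "'a mat" and a l
    using poly_mat_dvd_zero[OF that(1), of "[:0, 1:] ^ l" "[:0, 1:] ^ a"] that
    by (simp add: poly_mat_power[OF that(1)] le_imp_power_dvd)
  have "(N + M) ^\<^sub>m k * (N ^\<^sub>m a * M ^\<^sub>m b) = 0\<^sub>m n n" if "i + j \<le> a + b + k" for a b k
    using that
  proof (induction k arbitrary: a b)
    case 0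
    then have "i \<le> a \<or> j \<le> b" by linarith
    then have "N ^\<^sub>m a * M ^\<^sub>m b = 0\<^sub>m n n"
      using zero[OF N ij(1)] zero[OF M ij(2)] c by fastforce
    then show ?case using N M by simp
  next
    case (Suc k)
    have "N * (N ^\<^sub>m a * M ^\<^sub>m b) = N ^\<^sub>m Suc a * M ^\<^sub>m b"
      using c pow_mat_commute[OF N N refl, of a] by (simp add: assoc_mult_mat[of _ n n _ n _ n, symmetric])
    moreover have "M * (N ^\<^sub>m a * M ^\<^sub>m b) = N ^\<^sub>m a * M ^\<^sub>m Suc b"
    proof -
      have "M * (N ^\<^sub>m a * M ^\<^sub>m b) = N ^\<^sub>m a * M * M ^\<^sub>m b"
        using c pow_mat_commute[OF N M NM, of a] by (simp add: assoc_mult_mat[of _ n n _ n _ n, symmetric])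
      then show ?thesis
        using c pow_mat_commute[OF M M refl, of b] by (simp add: assoc_mult_mat[of _ n n _ n _ n])
    qed
    ultimately have step: "(N + M) * (N ^\<^sub>m a * M ^\<^sub>m b) = N ^\<^sub>m Suc a * M ^\<^sub>m b + N ^\<^sub>m a * M ^\<^sub>m Suc b"
      using c by (subst add_mult_distrib_mat[OF N M]) auto
    have "(N + M) ^\<^sub>m Suc k * (N ^\<^sub>m a * M ^\<^sub>m b) = (N + M) ^\<^sub>m k * ((N + M) * (N ^\<^sub>m a * M ^\<^sub>m b))"
      using c(1,2) by (simp, subst assoc_mult_mat[of _ n n _ n _ n]) (auto intro!: c pow_carrier_mat)
    also have "\<dots> = (N + M) ^\<^sub>m k * (N ^\<^sub>m Suc a * M ^\<^sub>m b) + (N + M) ^\<^sub>m k * (N ^\<^sub>m a * M ^\<^sub>m Suc b)"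
      unfolding step using c by (intro mult_add_distrib_mat[of _ n n _ n]) (auto simp del: pow_mat.simps)
    also have "\<dots> = 0\<^sub>m n n"
      using Suc.IH[of "Suc a" b] Suc.IH[of a "Suc b"] Suc.prems by (simp del: pow_mat.simps)
    finally show ?case .
  qed
  from this[of 0 0 "i + j"] have "(N + M) ^\<^sub>m (i + j) = 0\<^sub>m n n"
    using c by (simp add: carrier_matD)
  then show ?thesis using M by (auto simp: nilpotent_mat_def)
qed

lemma nilpotent_mat_uminus:
  fixes N :: "'a :: field mat"
  assumes N: "N \<in> carrier_mat n n" and "nilpotent_mat N"
  shows "nilpotent_mat (- N)"
proof -
  obtain j where j: "N ^\<^sub>m j = 0\<^sub>m n n" using assms by (auto simp: nilpotent_mat_def)
  have X: "poly_mat (- [:0, 1:]) N = - N"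
    using N by (auto simp: poly_mat_pCons intro!: eq_matI)
  have "(- N) ^\<^sub>m j = poly_mat ((- [:0, 1:]) ^ j) N"
    unfolding poly_mat_power[OF N] X ..
  also have "\<dots> = 0\<^sub>m n n"
  proof (rule poly_mat_dvd_zero[OF N])
    show "[:0, 1 :: 'a:] ^ j dvd (- [:0, 1:]) ^ j" by (intro dvd_power_same) (simp only: dvd_minus_iff dvd_refl)
    show "poly_mat ([:0, 1:] ^ j) N = 0\<^sub>m n n" using j N by (simp add: poly_mat_power[OF N])
  qed
  finally show ?thesis using N by (auto simp: nilpotent_mat_def)
qed

text \<open>Substituting \<open>E = E E S\<close> into itself repeatedly exhibits every power of \<open>E\<close> as a left factor of
\<open>E\<close>.\<close>

lemma zero_if_nilpotent_square_factor:
  assumes E: "E \<in> carrier_mat n n" and S: "S \<in> carrier_mat n n"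
    and "nilpotent_mat E" and ES: "E = E * E * S"
  shows "E = 0\<^sub>m n n"
proof -
  have "\<exists>T \<in> carrier_mat n n. E = E ^\<^sub>m k * T" for k
  proof (induction k)
    case 0
    show ?case using E by auto
  next
    case (Suc k)
    then obtain T where T: "T \<in> carrier_mat n n" "E = E ^\<^sub>m k * T" by blast
    have "E = E * E * S" by (fact ES)
    also have "\<dots> = E * (E ^\<^sub>m k * T) * S" using T(2) by simp
    also have "\<dots> = E * E ^\<^sub>m k * (T * S)"
      using E T(1) S pow_carrier_mat[OF E] by (simp add: assoc_mult_mat[of _ n n _ n _ n] mult_carrier_mat[of _ n n _ n])
    also have "E * E ^\<^sub>m k = E ^\<^sub>m Suc k" using pow_mat_commute[OF E E refl, of k] by simp
    finally show ?case using T(1) S mult_carrier_mat by blast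
  qed
  moreover obtain j where "E ^\<^sub>m j = 0\<^sub>m n n" using assms by (auto simp: nilpotent_mat_def)
  ultimately show ?thesis by (metis left_mult_zero_mat)
qed

section \<open>Commuting matrices with nilpotent difference\<close>

text \<open>Every multiple of \<open>E\<close> is kept as a left multiple,
so that the induction step, which multiplies by \<open>D + E\<close> on the right, never has to move the
unknown remainder \<open>R\<close>.\<close>

lemma poly_mat_add_taylor:
  assumes D: "D \<in> carrier_mat n n" and E: "E \<in> carrier_mat n n" and DE: "D * E = E * D"
  shows "\<exists>R \<in> carrier_mat n n.
    poly_mat p (D + E) = poly_mat p D + E * poly_mat (pderiv p) D + E * E * R"
proof (induction p)
  case 0
  show ?case using D E by (intro bexI[of _ "0\<^sub>m n n"]) auto
next
  case (pCons c p)
  then obtain R where R: "R \<in> carrier_mat n n"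
    and p: "poly_mat p (D + E) = poly_mat p D + E * poly_mat (pderiv p) D + E * E * R" by blast
  define P P' where "P = poly_mat p D" and "P' = poly_mat (pderiv p) D"
  have PP': "P \<in> carrier_mat n n" "P' \<in> carrier_mat n n" using D by (auto simp: P_def P'_def)
  have DEc: "D + E \<in> carrier_mat n n" using D E by simp
  have PE: "P * E = E * P" "P' * E = E * P'"
    using poly_mat_commute[OF D E DE] by (simp_all add: P_def P'_def)
  note c = D E R PP' DEc mult_carrier_mat[of _ n n _ n]
  note distr = add_mult_distrib_mat[of _ n n _ _ n] mult_add_distrib_mat[of _ n n _ n]
  note assoc = assoc_mult_mat[of _ n n _ n _ n]
  define R' where "R' = R * (D + E) + P'"
  have EP': "E * P' * (D + E) = E * (P' * D) + E * E * P'"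
    using c by (simp add: assoc distr PE)
  have PDE: "P * (D + E) = P * D + E * P" using c by (simp add: distr PE)
  have zero: "0 \<cdot>\<^sub>m 1\<^sub>m n + P' * D = P' * D"
    using c by (intro eq_matI) (auto simp del: index_mult_mat(1))
  have deriv: "poly_mat (pderiv (pCons c p)) D = P + P' * D"
    using zero by (simp only: pderiv_pCons poly_mat_add[OF D] poly_mat_pCons[OF D] P_def P'_def)
  have EP'c: "E * P' \<in> carrier_mat n n" and EERc: "E * E * R \<in> carrier_mat n n"
    using c by simp_all
  have ERR: "E * E * R * (D + E) = E * E * (R * (D + E))" using c by (simp add: assoc)
  have "poly_mat (pCons c p) (D + E) = c \<cdot>\<^sub>m 1\<^sub>m n + (P + E * P' + E * E * R) * (D + E)"
    unfolding poly_mat_pCons[OF DEc] p P_def P'_def ..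
  also have "(P + E * P' + E * E * R) * (D + E) = P * (D + E) + E * P' * (D + E) + E * E * R * (D + E)"
    using add_mult_distrib_mat[OF add_carrier_mat[OF EP'c] EERc DEc, of P]
      add_mult_distrib_mat[OF PP'(1) EP'c DEc] by simp
  also have "c \<cdot>\<^sub>m 1\<^sub>m n + \<dots> = (c \<cdot>\<^sub>m 1\<^sub>m n + P * D) + E * (P + P' * D) + E * E * R'"
  proof -
    have "E * (P + P' * D) = E * P + E * (P' * D)" "E * E * R' = E * E * (R * (D + E)) + E * E * P'"
      using c unfolding R'_def by (intro mult_add_distrib_mat[of _ n n _ n]; simp)+
    then show ?thesis
      unfolding PDE EP' ERR using c by (auto intro!: eq_matI simp del: index_mult_mat(1))
  qed
  also have "\<dots> = poly_mat (pCons c p) D + E * poly_mat (pderiv (pCons c p)) D + E * E * R'"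
    unfolding deriv by (simp add: poly_mat_pCons[OF D] P_def)
  finally show ?case using c by (intro bexI[of _ R']) (auto simp: R'_def)
qed

lemma eq_neg_if_add_eq_0_mat:
  fixes A B :: "'a :: ring_1 mat"
  assumes A: "A \<in> carrier_mat n m" and B: "B \<in> carrier_mat n m" and sum: "A + B = 0\<^sub>m n m"
  shows "A = - B"
proof (rule eq_matI)
  fix i j assume "i < dim_row (- B)" "j < dim_col (- B)"
  then have ij: "i < n" "j < m" using B by auto
  have "(A + B) $$ (i, j) = 0" using sum ij by simp
  then show "A $$ (i, j) = (- B) $$ (i, j)"
    using ij A B by (simp add: eq_neg_iff_add_eq_0)
qed (use A B in auto)

text \<open>Put \<open>E = D' - D\<close>. A Bezout identity for \<open>q\<close> and \<open>q'\<close>, evaluated at \<open>D\<close>, shows that \<open>q'(D)\<close>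
has an inverse \<open>V\<close>; multiplying the Taylor expansion of \<open>0 = q(D + E)\<close> by \<open>V\<close> gives
\<open>E = - E\<^sup>2 R V\<close>.\<close>

lemma eq_if_separable_nilpotent_diff:
  fixes q :: "'a :: field poly"
  assumes D: "D \<in> carrier_mat n n" and D': "D' \<in> carrier_mat n n" and comm: "D * D' = D' * D"
    and q: "coprime q (pderiv q)" "poly_mat q D = 0\<^sub>m n n" "poly_mat q D' = 0\<^sub>m n n"
    and nil: "nilpotent_mat (D' - D)"
  shows "D' = D"
proof -
  define E where "E = D' - D"
  have E: "E \<in> carrier_mat n n" using D D' by (auto simp: E_def)
  have DE: "D * E = E * D"
    using D D' comm by (simp add: E_def mult_minus_distrib_mat[of _ n n _ n] minus_mult_distrib_mat[of _ n n _ _ n])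
  have "D' = D + E" using D D' by (auto simp: E_def intro!: eq_matI)
  then obtain R where R: "R \<in> carrier_mat n n"
    and taylor: "poly_mat q D + E * poly_mat (pderiv q) D + E * E * R = 0\<^sub>m n n"
    using poly_mat_add_taylor[OF D E DE, of q] q(3) by metis
  define Q where "Q = poly_mat (pderiv q) D"
  have Q: "Q \<in> carrier_mat n n" using D by (simp add: Q_def)
  obtain u v where "u * q + v * pderiv q dvd q" "u * q + v * pderiv q dvd pderiv q"
    using bezout_poly by blast
  with q(1) have "u * q + v * pderiv q dvd 1" by (rule coprime_common_divisor)
  then obtain w where w: "1 = (u * q + v * pderiv q) * w" by blast
  define V where "V = poly_mat (v * w) D"
  have V: "V \<in> carrier_mat n n" using D by (simp add: V_def)
  note c = D E R Q V mult_carrier_mat[of _ n n _ n]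
  have "q * (u * w) + pderiv q * (v * w) = (u * q + v * pderiv q) * w"
    by (simp add: algebra_simps)
  then have "1\<^sub>m n = poly_mat (q * (u * w) + pderiv q * (v * w)) D"
    using D by (simp only: w[symmetric] poly_mat_1)
  also have "\<dots> = Q * V"
    using c poly_mat_carrier[OF D, of "u * w"]
    by (simp only: poly_mat_add[OF D] poly_mat_mult[OF D, of q] poly_mat_mult[OF D, of "pderiv q"] q(2) Q_def V_def
      left_mult_zero_mat left_add_zero_mat[OF mult_carrier_mat[OF Q V, unfolded Q_def V_def]])
  finally have QV: "Q * V = 1\<^sub>m n" ..
  have "E * Q + E * E * R = 0\<^sub>m n n" using taylor c by (simp add: q(2) Q_def)
  then have "E * Q = - (E * E * R)"
    using c by (intro eq_neg_if_add_eq_0_mat[of _ n n]) simp_all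
  then have "E * Q = E * E * (- R)"
    using c by (simp add: uminus_mult_right_mat)
  then have "E * (Q * V) = E * E * (- R * V)"
    using assoc_mult_mat[OF E Q V] assoc_mult_mat[OF mult_carrier_mat[OF E E] uminus_carrier_mat[OF R] V]
    by simp
  then have "E = E * E * (- R * V)" using E by (simp add: QV)
  then have "E = 0\<^sub>m n n"
    using c nil by (intro zero_if_nilpotent_square_factor[of E n "- R * V"]) (auto simp: E_def)
  with \<open>D' = D + E\<close> D show ?thesis by simp
qed

lemma poly_mat_eq_zero_mono:
  assumes "A \<in> carrier_mat n n" "finite T" "S \<subseteq> T" "poly_mat (prod f S) A = 0\<^sub>m n n"
  shows "poly_mat (prod f T) A = 0\<^sub>m n n"
  using assms by (intro poly_mat_dvd_zero[OF assms(1) _ assms(4)] prod_dvd_prod_subset)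

text \<open>Each matrix is killed by the product of \<open>X - a\<close> over a finite set of scalars \<open>a\<close>; the
product over the union of the two sets kills both and is still separable.\<close>

lemma diagonalizable_eq_if_nilpotent_diff:
  assumes D: "D \<in> carrier_mat n n" and D': "D' \<in> carrier_mat n n" and comm: "D * D' = D' * D"
    and "diagonalizable D" "diagonalizable D'" and nil: "nilpotent_mat (D' - D)"
  shows "D' = D"
proof -
  obtain S where S: "finite S" "poly_mat (\<Prod>a\<in>S. [:- a, 1:]) D = 0\<^sub>m n n"
    using annihilator_if_diagonalizable[OF D] assms by blast
  obtain S' where S': "finite S'" "poly_mat (\<Prod>a\<in>S'. [:- a, 1:]) D' = 0\<^sub>m n n"
    using annihilator_if_diagonalizable[OF D'] assms by blast
  have fin: "finite (S \<union> S')" using S(1) S'(1) by simp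
  show ?thesis
    by (rule eq_if_separable_nilpotent_diff[OF D D' comm coprime_pderiv_prod_linear[OF fin] _ _ nil])
      (rule poly_mat_eq_zero_mono[OF D fin _ S(2)] poly_mat_eq_zero_mono[OF D' fin _ S'(2)], simp)+
qed

lemma semisimple_eq_if_nilpotent_diff:
  assumes D: "D \<in> carrier_mat n n" and D': "D' \<in> carrier_mat n n" and comm: "D * D' = D' * D"
    and ss: "semisimple D" "semisimple D'" and "nilpotent_mat (D' - D)"
  shows "D' = D"
proof -
  interpret h: field_hom to_ac by (fact field_hom_to_ac)
  interpret h: inj_idom_hom to_ac ..
  have c: "map_mat to_ac D \<in> carrier_mat n n" "map_mat to_ac D' \<in> carrier_mat n n" using D D' by auto
  have diff: "D' - D \<in> carrier_mat n n" by (rule minus_carrier_mat[OF D])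
  obtain j where j: "(D' - D) ^\<^sub>m j = 0\<^sub>m n n"
    using assms D by (auto simp: nilpotent_mat_def)
  have zero: "map_mat to_ac (0\<^sub>m n n) = 0\<^sub>m n n" by (rule eq_matI) auto
  have "map_mat to_ac D' - map_mat to_ac D = map_mat to_ac (D' - D)"
    using D D' by (auto intro!: eq_matI simp: h.hom_minus)
  then have "(map_mat to_ac D' - map_mat to_ac D) ^\<^sub>m j = 0\<^sub>m n n"
    using h.mat_hom_pow[OF diff, of j] zero by (metis j)
  then have nil: "nilpotent_mat (map_mat to_ac D' - map_mat to_ac D)"
    using D by (auto simp: nilpotent_mat_def)
  have "map_mat to_ac D * map_mat to_ac D' = map_mat to_ac D' * map_mat to_ac D"
    using comm by (simp add: h.mat_hom_mult[OF D D', symmetric] h.mat_hom_mult[OF D' D, symmetric])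
  then have "map_mat to_ac D' = map_mat to_ac D"
    using diagonalizable_eq_if_nilpotent_diff[OF c] ss nil by (simp add: semisimple_def)
  then show ?thesis by (simp add: h.mat_hom_inj)
qed

section \<open>The Jordan--Chevalley decomposition\<close>

lemma semisimple_if_square_free:
  assumes A: "A \<in> carrier_mat n n" and g: "square_free g" "poly_mat g A = 0\<^sub>m n n"
  shows "semisimple A"
proof -
  interpret h: field_hom to_ac by (fact field_hom_to_ac)
  interpret mh: map_poly_inj_idom_hom to_ac ..
  have "poly_mat (map_poly to_ac g) (map_mat to_ac A) = 0\<^sub>m n n"
    unfolding poly_mat_hom[OF field_hom_to_ac A] g(2) by (rule eq_matI) auto
  then show ?thesis
    unfolding semisimple_def using A g(1)
    by (intro diagonalizable_if_separable[of _ n "map_poly to_ac g"])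
      (simp_all add: square_free_def coprime_pderiv_hom[OF field_hom_to_ac])
qed

text \<open>The semisimple part being a polynomial in \<open>A\<close> is what makes it commute with any competitor
\<open>D'\<close>, of which it is only known that it commutes with \<open>A\<close>.\<close>

lemma jordan_chevalley_unique:
  assumes A: "A \<in> carrier_mat n n"
    and jc: "jordan_chevalley n A (poly_mat r A) N" and jc': "jordan_chevalley n A D' N'"
  shows "D' = poly_mat r A \<and> N' = N"
proof -
  define D where "D = poly_mat r A"
  have D: "D \<in> carrier_mat n n" using A by (simp add: D_def)
  have N: "N \<in> carrier_mat n n" "A = D + N" "nilpotent_mat N" "semisimple D"
    using jc by (auto simp: jordan_chevalley_def D_def)
  have D': "D' \<in> carrier_mat n n" "N' \<in> carrier_mat n n" "A = D' + N'" "D' * N' = N' * D'"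
      "nilpotent_mat N'" "semisimple D'"
    using jc' by (auto simp: jordan_chevalley_def)
  have "A * D' = D' * A" "A * N' = N' * A"
    using D' by (simp_all add: D'(3) add_mult_distrib_mat[of _ n n _ _ n] mult_add_distrib_mat[of _ n n _ n])
  then have comm: "D * D' = D' * D" "D * N' = N' * D"
    using poly_mat_commute[OF A] D' by (auto simp: D_def)
  have NA: "N = A - D" "N' = A - D'"
  proof -
    show "N = A - D" using D N(1) by (subst N(2)) (auto intro!: eq_matI)
    show "N' = A - D'" using D' by (subst D'(3)) (auto intro!: eq_matI)
  qed
  have "N * N' = N' * N"
    using A D D' comm \<open>A * N' = N' * A\<close>
    by (simp add: NA(1) mult_minus_distrib_mat[of _ n n _ n] minus_mult_distrib_mat[of _ n n _ _ n])
  then have "N * - N' = - N' * N"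
    using N D' by (simp add: uminus_mult_right_mat uminus_mult_left_mat)
  then have "nilpotent_mat (N + - N')"
    using N D' by (intro nilpotent_mat_add nilpotent_mat_uminus[of _ n]) auto
  moreover have "N + - N' = D' - D"
    unfolding NA using A D D' by (auto intro!: eq_matI)
  ultimately have "D' = D"
    using semisimple_eq_if_nilpotent_diff[OF D D'(1) comm(1)] N D' by simp
  then show ?thesis using NA by (simp add: D_def)
qed

theorem theorem7:
  fixes n m k0 :: nat
    and A :: "'a :: field mat"
    and f g gt gt' :: "'a poly"
    and As :: "nat \<Rightarrow> 'a mat"
  assumes "A \<in> carrier_mat n n"
    and "degree f > 0" and "poly_mat f A = 0\<^sub>m n n"
    and "square_free g" and "g dvd f" and "f dvd g ^ m"
    and "1 = gt * pderiv g + gt' * g"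
    and "As 0 = A"
    and "\<And>k. As (Suc k) = As k - poly_mat g (As k) * poly_mat gt (As k)"
    and "2 ^ k0 \<ge> m"
  shows "poly_mat g (As k0) = 0\<^sub>m n n \<and>
    semisimple (As k0) \<and>
    nilpotent_mat (A - As k0) \<and>
    As k0 \<in> {poly_mat r A | r. True} \<and>
    jordan_chevalley n A (As k0) (A - As k0) \<and>
    (\<forall>D N. jordan_chevalley n A D N \<longrightarrow> D = As k0 \<and> N = A - As k0)"
proof -
  note A = assms(1)
  have As: "As k = poly_mat (newton_poly g gt k) A" for k
  proof (induction k)
    case (Suc k)
    then show ?case
      by (simp add: assms(9) poly_mat_diff[OF A] poly_mat_mult[OF A] poly_mat_pcompose[OF A])
  qed (use A assms(8) in simp)
  define r where "r = newton_poly g gt k0"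
  have Ask: "As k0 = poly_mat r A" by (simp add: As r_def)
  have D: "As k0 \<in> carrier_mat n n" using A by (simp add: Ask)
  have "f dvd g ^ (2 ^ k0)"
    using assms(6,10) le_imp_power_dvd dvd_trans by blast
  then have "f dvd g \<circ>\<^sub>p r"
    using power_dvd_newton_poly[OF assms(7), of k0] dvd_trans unfolding r_def by blast
  then have g0: "poly_mat g (As k0) = 0\<^sub>m n n"
    using poly_mat_dvd_zero[OF A _ assms(3)] by (simp add: Ask poly_mat_pcompose[OF A, symmetric])
  have ss: "semisimple (As k0)" by (rule semisimple_if_square_free[OF D assms(4) g0])
  have N: "A - As k0 = poly_mat ([:0, 1:] - r) A"
    using A by (simp only: Ask poly_mat_diff poly_mat_X)
  have "f dvd ([:0, 1:] - r) ^ m"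
    using dvd_trans[OF assms(6) dvd_power_same[OF dvd_X_minus_newton_poly[OF assms(7)]]] by (simp add: r_def)
  then have "(A - As k0) ^\<^sub>m m = 0\<^sub>m n n"
    unfolding N poly_mat_power[OF A, symmetric] using poly_mat_dvd_zero[OF A _ assms(3)] by blast
  then have nil: "nilpotent_mat (A - As k0)"
    using D by (auto simp: nilpotent_mat_def)
  have "poly_mat r A * poly_mat ([:0, 1:] - r) A = poly_mat ([:0, 1:] - r) A * poly_mat r A"
    by (simp only: poly_mat_mult[OF A, symmetric] mult.commute)
  then have "As k0 * (A - As k0) = (A - As k0) * As k0"
    by (simp only: N[symmetric] Ask[symmetric])
  moreover have "A = As k0 + (A - As k0)" using A D by (auto intro!: eq_matI)
  ultimately have jc: "jordan_chevalley n A (As k0) (A - As k0)"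
    using A D ss nil minus_carrier_mat[OF D, of A] unfolding jordan_chevalley_def by blast
  then show ?thesis
    using g0 ss nil jordan_chevalley_unique[OF A] Ask by auto
qed

end
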